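(* Let $a,b$ be nonzero real numbers. For every $n\in\mathbb{N}=\{0,1,2,\dots\}$, the bi-periodic Fibonacci matrix sequence satisfies the Binet formula $$\mathcal{F}_n(a,b)=A_1\left(\alpha^n-\beta^n\right)+B_1\left(\alpha^{2\lfloor n/2\rfloor+2}-\beta^{2\lfloor n/2\rfloor+2}\right),$$ where $$A_1=\frac{\left[\mathcal{F}_1(a,b)-b\mathcal{F}_0(a,b)\right]^{\varepsilon(n)}\left[a\mathcal{F}_1(a,b)-\mathcal{F}_0(a,b)-ab\,\mathcal{F}_0(a,b)\right]^{1-\varepsilon(n)}}{(ab)^{\lfloor n/2\rfloor}(\alpha-\beta)},$$ $$B_1=\frac{b^{\varepsilon(n)}\mathcal{F}_0(a,b)}{(ab)^{\lfloor n/2\rfloor+1}(\alpha-\beta)},$$ such that $$\alpha=\frac{ab+\sqrt{a^2b^2+4ab}}{2},\qquad \beta=\frac{ab-\sqrt{a^2b^2+4ab}}{2},$$ and $\varepsilon(n)=n-2\lfloor n/2\rfloor$.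
   Context: For nonzero real numbers $a,b$, the bi-periodic Fibonacci matrix sequence $(\mathcal{F}_n(a,b))_{n\ge 0}$ of $2\times 2$ matrices is defined by the initial conditions $\mathcal{F}_0(a,b)=\begin{pmatrix}1&0\\0&1\end{pmatrix}$, $\mathcal{F}_1(a,b)=\begin{pmatrix}b&\frac{b}{a}\\1&0\end{pmatrix}$, and, for $n\ge 2$, by $\mathcal{F}_n(a,b)=a\mathcal{F}_{n-1}(a,b)+\mathcal{F}_{n-2}(a,b)$ if $n$ is even and $\mathcal{F}_n(a,b)=b\mathcal{F}_{n-1}(a,b)+\mathcal{F}_{n-2}(a,b)$ if $n$ is odd. The numbers $\alpha,\beta$ are the roots of $X^2-abX-ab=0$. The zeroth power of a matrix is the identity matrix.
   Formalization: The formula is proved under the extra condition α ≠ β (that is, ab ≠ -4), since for ab = -4 the coefficients A_1 and B_1 divide by zero; when a²b²+4ab is negative, α and β are taken as complex numbers. *)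

theory Defs
  imports Complex_Main "Jordan_Normal_Form.Matrix"
begin

fun bifib_mat :: "real \<Rightarrow> real \<Rightarrow> nat \<Rightarrow> real mat" where
  "bifib_mat a b 0 = mat_of_rows_list 2 [[1, 0], [0, 1]]"
| "bifib_mat a b (Suc 0) = mat_of_rows_list 2 [[b, b / a], [1, 0]]"
| "bifib_mat a b (Suc (Suc n)) =
    (if even (Suc (Suc n)) then a else b) \<cdot>\<^sub>m bifib_mat a b (Suc n) + bifib_mat a b n"

(* For -4 < ab < 0 the discriminant a^2 b^2 + 4ab is negative, so the roots are taken in the
   complex numbers.  On nonnegative reals csqrt is the usual real square root. *)
definition binet_alpha :: "real \<Rightarrow> real \<Rightarrow> complex" where
  "binet_alpha a b = (of_real (a * b) + csqrt (of_real (a\<^sup>2 * b\<^sup>2 + 4 * a * b))) / 2"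

definition binet_beta :: "real \<Rightarrow> real \<Rightarrow> complex" where
  "binet_beta a b = (of_real (a * b) - csqrt (of_real (a\<^sup>2 * b\<^sup>2 + 4 * a * b))) / 2"

definition parity_eps :: "nat \<Rightarrow> nat" where
  "parity_eps n = n - 2 * (n div 2)"

(* The matrix numerators are real; they are embedded entrywise into the complex matrices before
   being divided by the complex denominators. *)
definition binet_A1 :: "real \<Rightarrow> real \<Rightarrow> nat \<Rightarrow> complex mat" where
  "binet_A1 a b n =
    (1 / (of_real (a * b) ^ (n div 2) * (binet_alpha a b - binet_beta a b))) \<cdot>\<^sub>m
    map_mat of_real
      ((bifib_mat a b 1 - b \<cdot>\<^sub>m bifib_mat a b 0) ^\<^sub>m parity_eps n *
       (a \<cdot>\<^sub>m bifib_mat a b 1 - bifib_mat a b 0 - (a * b) \<cdot>\<^sub>m bifib_mat a b 0)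
         ^\<^sub>m (1 - parity_eps n))"

definition binet_B1 :: "real \<Rightarrow> real \<Rightarrow> nat \<Rightarrow> complex mat" where
  "binet_B1 a b n =
    (1 / (of_real (a * b) ^ (n div 2 + 1) * (binet_alpha a b - binet_beta a b))) \<cdot>\<^sub>m
    map_mat of_real (b ^ parity_eps n \<cdot>\<^sub>m bifib_mat a b 0)"

end

theory Submission
  imports Defs
begin

text \<open>
  The recurrence acts on each matrix entry separately, so it is enough to treat a scalar sequence
  \<open>x\<close> with the two alternating coefficients. Put
  \<open>u m = (\<alpha> ^ (2 * m) - \<beta> ^ (2 * m)) / ((a * b) ^ m * (\<alpha> - \<beta>))\<close> and
  \<open>v m = (\<alpha> ^ (2 * m + 1) - \<beta> ^ (2 * m + 1)) / ((a * b) ^ m * (\<alpha> - \<beta>))\<close>.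
  Since \<open>\<alpha>\<close> and \<open>\<beta>\<close> are roots of \<open>X\<^sup>2 = a * b * (X + 1)\<close>, dividing by one factor \<open>a * b\<close> for every two
  indices turns the constant-coefficient recurrence of \<open>\<alpha> ^ n - \<beta> ^ n\<close> into the alternating pair
  \<open>u (m + 1) = v m + u m\<close> and \<open>v (m + 1) = a * b * u (m + 1) + v m\<close>
  (lemma \<open>normalized_power_difference_rec\<close>).
  This pair describes exactly how the even and the odd terms of \<open>x\<close> arise from \<open>x 0\<close> and
  \<open>x 1\<close>, so induction on \<open>m\<close> gives both halves of the formula at once (lemma \<open>biperiodic_binet\<close>).
  The theorem applies this to the four entries.
\<close>

text \<open>
  Both differences obey \<open>d (k + 2) = c * (d (k + 1) + d k)\<close>, and raising \<open>m\<close> by one puts exactly one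
  more factor \<open>c\<close> into the denominator. For \<open>u\<close> it cancels the factor \<open>c\<close> completely; for \<open>v\<close> one
  \<open>c\<close> survives, because \<open>u (m + 1)\<close> already carries the larger denominator.
\<close>
lemma normalized_power_difference_rec:
  fixes c p q :: "'a :: field"
  assumes p: "p\<^sup>2 = c * (p + 1)" and q: "q\<^sup>2 = c * (q + 1)" and c: "c \<noteq> 0"
  defines "u \<equiv> \<lambda>m. (p ^ (2 * m) - q ^ (2 * m)) / (c ^ m * (p - q))"
    and "v \<equiv> \<lambda>m. (p ^ (2 * m + 1) - q ^ (2 * m + 1)) / (c ^ m * (p - q))"
  shows "u (m + 1) = v m + u m" and "v (m + 1) = c * u (m + 1) + v m"
proof -
  have power_rec: "r ^ (k + 2) = c * (r ^ (k + 1) + r ^ k)" if "r\<^sup>2 = c * (r + 1)" for r k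
  proof -
    have "r ^ (k + 2) = r\<^sup>2 * r ^ k" by (simp add: power2_eq_square)
    then show ?thesis by (simp add: that algebra_simps)
  qed
  have diff_rec: "p ^ (k + 2) - q ^ (k + 2) = c * ((p ^ (k + 1) - q ^ (k + 1)) + (p ^ k - q ^ k))"
    for k
    unfolding power_rec[OF p] power_rec[OF q] by (simp only: algebra_simps)
  have cancel: "c * y / (c ^ (m + 1) * (p - q)) = y / (c ^ m * (p - q))" for y
    using c by simp
  have "u (m + 1) = (c * ((p ^ (2 * m + 1) - q ^ (2 * m + 1)) + (p ^ (2 * m) - q ^ (2 * m))))
      / (c ^ (m + 1) * (p - q))"
    using diff_rec[of "2 * m"] by (simp add: u_def)
  then show "u (m + 1) = v m + u m"
    unfolding cancel by (simp add: u_def v_def add_divide_distrib)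
  have "v (m + 1) = (c * ((p ^ (2 * m + 2) - q ^ (2 * m + 2)) + (p ^ (2 * m + 1) - q ^ (2 * m + 1))))
      / (c ^ (m + 1) * (p - q))"
    using diff_rec[of "2 * m + 1"] by (simp add: v_def)
  also have "\<dots> = c * u (m + 1)
      + c * (p ^ (2 * m + 1) - q ^ (2 * m + 1)) / (c ^ (m + 1) * (p - q))"
    by (simp add: u_def distrib_left add_divide_distrib)
  finally show "v (m + 1) = c * u (m + 1) + v m"
    unfolding cancel by (simp add: v_def)
qed

text \<open>
  The even and the odd formula must be proved by one simultaneous induction, because each new term
  uses the last two terms, which have opposite parities.
\<close>
lemma biperiodic_binet:
  fixes x :: "nat \<Rightarrow> 'a :: field" and a b p q :: 'a
  assumes rec: "\<And>n. x (Suc (Suc n)) = (if even n then a else b) * x (Suc n) + x n"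
    and p: "p\<^sup>2 = a * b * (p + 1)" and q: "q\<^sup>2 = a * b * (q + 1)"
    and ab: "a * b \<noteq> 0" and pq: "p \<noteq> q"
  defines "u \<equiv> \<lambda>m. (p ^ (2 * m) - q ^ (2 * m)) / ((a * b) ^ m * (p - q))"
    and "v \<equiv> \<lambda>m. (p ^ (2 * m + 1) - q ^ (2 * m + 1)) / ((a * b) ^ m * (p - q))"
  shows "x (2 * m) = u m * (a * x 1 - x 0 - a * b * x 0) + u (m + 1) * x 0"
    and "x (2 * m + 1) = v m * (x 1 - b * x 0) + u (m + 1) * (b * x 0)"
proof -
  have uv_rec: "u (m + 1) = v m + u m" "v (m + 1) = a * b * u (m + 1) + v m" for m
    using normalized_power_difference_rec[OF p q ab] unfolding u_def v_def by blast+
  have even_step: "x (2 * m + 2) = a * x (2 * m + 1) + x (2 * m)"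
    and odd_step: "x (2 * m + 3) = b * x (2 * m + 2) + x (2 * m + 1)" for m
    using rec[of "2 * m"] rec[of "2 * m + 1"] by (simp_all add: numeral_3_eq_3)
  have "x (2 * m) = u m * (a * x 1 - x 0 - a * b * x 0) + u (m + 1) * x 0 \<and>
    x (2 * m + 1) = v m * (x 1 - b * x 0) + u (m + 1) * (b * x 0)"
  proof (induction m)
    case 0
    have "u 0 = 0" "v 0 = 1" using pq by (simp_all add: u_def v_def)
    moreover from this have "u 1 = 1" using uv_rec(1)[of 0] by simp
    ultimately show ?case by simp
  next
    case (Suc m)
    have even_term: "x (2 * m + 2) =
        u (m + 1) * (a * x 1 - x 0 - a * b * x 0) + u (m + 1 + 1) * x 0"
      unfolding even_step conjunct1[OF Suc.IH] conjunct2[OF Suc.IH] uv_rec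
      by (simp add: algebra_simps)
    have "x (2 * m + 3) = v (m + 1) * (x 1 - b * x 0) + u (m + 1 + 1) * (b * x 0)"
      unfolding odd_step even_term conjunct2[OF Suc.IH] uv_rec
      by (simp add: algebra_simps)
    with even_term show ?case by (simp add: numeral_3_eq_3)
  qed
  then show "x (2 * m) = u m * (a * x 1 - x 0 - a * b * x 0) + u (m + 1) * x 0"
    and "x (2 * m + 1) = v m * (x 1 - b * x 0) + u (m + 1) * (b * x 0)"
    by simp_all
qed

lemma binet_roots:
  fixes a b :: real
  defines "c \<equiv> complex_of_real a * complex_of_real b"
  shows "(binet_alpha a b)\<^sup>2 = c * (binet_alpha a b + 1)"
    and "(binet_beta a b)\<^sup>2 = c * (binet_beta a b + 1)"
proof -
  define s where "s = csqrt (of_real (a\<^sup>2 * b\<^sup>2 + 4 * a * b))"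
  have s: "s\<^sup>2 = c\<^sup>2 + 4 * c"
    by (simp add: s_def c_def power_mult_distrib)
  have "((c + t) / 2)\<^sup>2 = c * ((c + t) / 2 + 1)" if "t\<^sup>2 = c\<^sup>2 + 4 * c" for t :: complex
    unfolding power_divide power2_sum that by (simp add: field_simps power2_eq_square)
  from this[of s] this[of "- s"] s
  show "(binet_alpha a b)\<^sup>2 = c * (binet_alpha a b + 1)"
    and "(binet_beta a b)\<^sup>2 = c * (binet_beta a b + 1)"
    by (simp_all add: binet_alpha_def binet_beta_def s_def c_def)
qed

lemma bifib_mat_carrier [simp]: "bifib_mat a b n \<in> carrier_mat 2 2"
  by (induction a b n rule: bifib_mat.induct) (auto simp: mat_of_rows_list_def)

lemma bifib_mat_dims [simp]:
  "dim_row (bifib_mat a b n) = 2" "dim_col (bifib_mat a b n) = 2"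
  using bifib_mat_carrier[of a b n] by (simp_all only: carrier_matD)

theorem theorem2p6:
  fixes a b :: real and n :: nat
  assumes "a \<noteq> 0" and "b \<noteq> 0"
    and "binet_alpha a b \<noteq> binet_beta a b"
  shows "map_mat complex_of_real (bifib_mat a b n) =
    (binet_alpha a b ^ n - binet_beta a b ^ n) \<cdot>\<^sub>m binet_A1 a b n +
    (binet_alpha a b ^ (2 * (n div 2) + 2) - binet_beta a b ^ (2 * (n div 2) + 2))
      \<cdot>\<^sub>m binet_B1 a b n"
proof -
  define F where "F = bifib_mat a b"
  have F_dims [simp]: "F k \<in> carrier_mat 2 2" "dim_row (F k) = 2" "dim_col (F k) = 2" for k
    by (simp_all add: F_def)
  have rec: "complex_of_real (F (Suc (Suc k)) $$ (i, j)) =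
      (if even k then of_real a else of_real b) * of_real (F (Suc k) $$ (i, j)) + of_real (F k $$ (i, j))"
    if "i < 2" "j < 2" for i j k
    using that by (simp add: F_def)
  have ab: "complex_of_real a * complex_of_real b \<noteq> 0"
    using assms(1,2) by simp
  note entry_binet = biperiodic_binet[where x = "\<lambda>k. complex_of_real (F k $$ (i, j))" for i j,
      OF rec binet_roots ab assms(3)]
  let ?E = "a \<cdot>\<^sub>m F 1 - F 0 - (a * b) \<cdot>\<^sub>m F 0"
  let ?O = "F 1 - b \<cdot>\<^sub>m F 0"
  have carriers: "?E \<in> carrier_mat 2 2" "?O \<in> carrier_mat 2 2"
    by (auto intro!: minus_carrier_mat smult_carrier_mat)
  \<comment> \<open>The exponents are 0 and 1 in some order, so one of the two powers is the identity matrix.\<close>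
  have numerator: "?O ^\<^sub>m parity_eps n * ?E ^\<^sub>m (1 - parity_eps n) = (if even n then ?E else ?O)"
  proof (cases "even n")
    case True
    then have "parity_eps n = 0" by (auto simp: parity_eps_def)
    then show ?thesis using True carriers by simp
  next
    case False
    then have "parity_eps n = 1" by (auto simp: parity_eps_def elim!: oddE)
    then show ?thesis using False carriers by simp
  qed
  show ?thesis
    unfolding binet_A1_def binet_B1_def F_def[symmetric] numerator
  proof (rule eq_matI, goal_cases)
    case (1 i j)
    then have ij: "i < 2" "j < 2" by simp_all
    show ?case
    proof (cases "even n")
      case True
      then obtain m where n: "n = 2 * m" by blast
      then have "parity_eps n = 0" by (simp add: parity_eps_def)
      then show ?thesis
        using entry_binet(1)[OF ij, of m] ij by (simp add: n)
    next
      case False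
      then obtain m where n: "n = 2 * m + 1" by (elim oddE)
      then have "parity_eps n = 1" by (simp add: parity_eps_def)
      then show ?thesis
        using entry_binet(2)[OF ij, of m] ij by (simp add: n)
    qed
  qed simp_all
qed

end
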